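(* Let $u$ be a Leray solution of the 3D Navier-Stokes equations on $\mathbb{R}^3$ (unit viscosity, no force) with initial datum $u_0$, let $\omega=\operatorname{curl}u$, and assume that $\omega\in C((0,T^* ),L^\infty)$ for some $T^*>0$. Let $h^*=\frac{2}{\pi}\arcsin\frac{1-(\frac34)^{2/3}}{1+(\frac34)^{2/3}}$ and let $M$ be the solution of $\frac12 h^*+(1-h^* )M=1$ (so $1<M<\frac32$). Then there is a constant $c(\|u_0\|_2)>0$ depending only on the initial energy (i.e. only on $\|u_0\|_2$) such that, with $$r^*=c(\|u_0\|_2)\,\frac{1}{\|\omega(\tau)\|_\infty^{2/5}},$$ for every $\tau\in(0,T^* )$ for which $r^*\le 1$, the super-level sets $$V_\tau^{j,\pm}=\left\{x\in\mathbb{R}^3:\ \omega_j^\pm(x,\tau)>\frac{1}{2M}\|\omega(\tau)\|_\infty\right\},\qquad j=1,2,3,$$ are 3D $\frac34$-sparse around every point $x_0\in\mathbb{R}^3$ at scale $r^*$.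
   Context: The Navier-Stokes equations are $\partial_t u+(u\cdot\nabla)u=\Delta u-\nabla p$, $\nabla\cdot u=0$ on $\mathbb{R}^3\times(0,\infty)$ with $u(\cdot,0)=u_0$. A Leray solution is a global-in-time weak solution satisfying the global energy inequality. Norm convention: for vorticity vectors $v=(a,b,c)$, $|v|=\max\{|a|,|b|,|c|\}$, and $\|\omega(\tau)\|_\infty$ is the corresponding sup norm over $\mathbb{R}^3$. For a scalar $f$, $f^+=\max(f,0)$ and $f^-=-\min(f,0)$; $\omega_j^\pm$ are the positive and negative parts of the component $\omega_j$. 3D sparseness: an open set $S\subset\mathbb{R}^3$ is 3D $\delta$-sparse ($\delta\in(0,1)$) around $x_0$ at scale $r>0$ if $\frac{m^3(S\cap B(x_0,r))}{m^3(B(x_0,r))}\le\delta$, where $m^3$ is three-dimensional Lebesgue measure and $B(x_0,r)$ is the ball of radius $r$ centered at $x_0$. *)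

theory Defs
  imports "HOL-Probability.Probability"
begin

section \<open>Test functions and weak derivatives\<close>

definition dir_deriv :: "'a::real_normed_vector \<Rightarrow> ('a \<Rightarrow> 'b::real_normed_vector) \<Rightarrow> 'a \<Rightarrow> 'b"
  where "dir_deriv v f x = frechet_derivative f (at x) v"

primrec ck :: "nat \<Rightarrow> ('a::euclidean_space \<Rightarrow> 'b::euclidean_space) \<Rightarrow> bool" where
  "ck 0 f \<longleftrightarrow> continuous_on UNIV f"
| "ck (Suc n) f \<longleftrightarrow> (\<forall>x. f differentiable at x) \<and> (\<forall>v. ck n (dir_deriv v f))"

definition test_function :: "('a::euclidean_space \<Rightarrow> 'b::euclidean_space) \<Rightarrow> bool"
  where "test_function \<phi> \<longleftrightarrow> (\<forall>n. ck n \<phi>) \<and> compact (closure {x. \<phi> x \<noteq> 0})"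

definition loc_integrable :: "('a::euclidean_space \<Rightarrow> 'b::euclidean_space) \<Rightarrow> bool"
  where "loc_integrable f \<longleftrightarrow> (\<forall>K. compact K \<longrightarrow> set_integrable lebesgue K f)"

definition partial :: "3 \<Rightarrow> (real^3 \<Rightarrow> 'b::real_normed_vector) \<Rightarrow> real^3 \<Rightarrow> 'b"
  where "partial j = dir_deriv (axis j 1)"

definition curl :: "(real^3 \<Rightarrow> real^3) \<Rightarrow> real^3 \<Rightarrow> real^3"
  where "curl f x = vector
    [partial 2 f x $ 3 - partial 3 f x $ 2,
     partial 3 f x $ 1 - partial 1 f x $ 3,
     partial 1 f x $ 2 - partial 2 f x $ 1]"

text \<open>The distributional identities are stated with the classical derivatives of the test
  function.  \<open>G x $ i $ j\<close> is the weak derivative of the component \<open>f\<^sub>i\<close> in direction \<open>j\<close>, so that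
  \<open>norm (G x)\<close> is the Frobenius norm of the gradient.\<close>

definition weak_gradient :: "(real^3 \<Rightarrow> real^3) \<Rightarrow> (real^3 \<Rightarrow> real^3^3) \<Rightarrow> bool"
  where "weak_gradient f G \<longleftrightarrow> loc_integrable f \<and> loc_integrable G \<and>
    (\<forall>\<psi> :: real^3 \<Rightarrow> real. test_function \<psi> \<longrightarrow>
      (\<forall>i j. (LINT x|lebesgue. f x $ i * partial j \<psi> x) = - (LINT x|lebesgue. G x $ i $ j * \<psi> x)))"

definition weak_curl :: "(real^3 \<Rightarrow> real^3) \<Rightarrow> (real^3 \<Rightarrow> real^3) \<Rightarrow> bool"
  where "weak_curl f w \<longleftrightarrow> loc_integrable f \<and> loc_integrable w \<and>
    (\<forall>\<psi> :: real^3 \<Rightarrow> real^3. test_function \<psi> \<longrightarrow>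
      (LINT x|lebesgue. w x \<bullet> \<psi> x) = (LINT x|lebesgue. f x \<bullet> curl \<psi> x))"

definition weakly_div_free :: "(real^3 \<Rightarrow> real^3) \<Rightarrow> bool"
  where "weakly_div_free f \<longleftrightarrow> loc_integrable f \<and>
    (\<forall>\<psi> :: real^3 \<Rightarrow> real. test_function \<psi> \<longrightarrow>
      (LINT x|lebesgue. (\<Sum>j\<in>UNIV. f x $ j * partial j \<psi> x)) = 0)"


section \<open>Lebesgue norms\<close>

definition L2 :: "('a::euclidean_space \<Rightarrow> 'b::euclidean_space) \<Rightarrow> bool"
  where "L2 f \<longleftrightarrow> f \<in> borel_measurable lebesgue \<and> integrable lebesgue (\<lambda>x. (norm (f x))\<^sup>2)"

definition L2_norm :: "('a::euclidean_space \<Rightarrow> 'b::euclidean_space) \<Rightarrow> real"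
  where "L2_norm f = sqrt (LINT x|lebesgue. (norm (f x))\<^sup>2)"

text \<open>On \<open>real^3\<close>, \<open>infnorm (a, b, c) = max {\<bar>a\<bar>, \<bar>b\<bar>, \<bar>c\<bar>}\<close>.  The real number \<open>Linf_norm w\<close> is
  meaningful only under \<open>Linf w\<close>.\<close>

definition Linf_esssup :: "(real^3 \<Rightarrow> real^3) \<Rightarrow> ereal"
  where "Linf_esssup w = esssup lebesgue (\<lambda>x. ereal (infnorm (w x)))"

definition Linf :: "(real^3 \<Rightarrow> real^3) \<Rightarrow> bool"
  where "Linf w \<longleftrightarrow> w \<in> borel_measurable lebesgue \<and> Linf_esssup w < \<infinity>"

definition Linf_norm :: "(real^3 \<Rightarrow> real^3) \<Rightarrow> real"
  where "Linf_norm w = real_of_ereal (Linf_esssup w)"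

definition continuous_into_Linf :: "real set \<Rightarrow> (real \<Rightarrow> real^3 \<Rightarrow> real^3) \<Rightarrow> bool"
  where "continuous_into_Linf I \<omega> \<longleftrightarrow> (\<forall>t\<in>I. Linf (\<omega> t)) \<and>
    (\<forall>t\<in>I. ((\<lambda>s. Linf_norm (\<lambda>x. \<omega> s x - \<omega> t x)) \<longlongrightarrow> 0) (at t within I))"


section \<open>Leray solutions\<close>

definition dt :: "(real \<times> (real^3) \<Rightarrow> real^3) \<Rightarrow> real \<times> (real^3) \<Rightarrow> real^3"
  where "dt = dir_deriv (1, 0)"

definition dx :: "3 \<Rightarrow> (real \<times> (real^3) \<Rightarrow> real^3) \<Rightarrow> real \<times> (real^3) \<Rightarrow> real^3"
  where "dx j = dir_deriv (0, axis j 1)"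

text \<open>Weak form of \<open>\<partial>\<^sub>t u + (u \<cdot> \<nabla>) u = \<Delta> u - \<nabla> p\<close>, \<open>\<nabla> \<cdot> u = 0\<close>, \<open>u(0) = u0\<close>.  The pressure is
  eliminated by solenoidal test functions; these live on all of \<open>real \<times> (real^3)\<close> and need not
  vanish at time \<open>0\<close>, which is how the initial datum enters.  The nonlinear term is
  \<open>- \<integral>\<integral> u \<bullet> (u \<cdot> \<nabla>) \<phi>\<close> after integration by parts.  The field \<open>u\<close> matters only for almost every
  positive time; \<open>G\<close> is its spatial gradient.\<close>

definition NS_weak_solution ::
    "(real^3 \<Rightarrow> real^3) \<Rightarrow> (real \<Rightarrow> real^3 \<Rightarrow> real^3) \<Rightarrow> (real \<Rightarrow> real^3 \<Rightarrow> real^3^3) \<Rightarrow> bool"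
  where "NS_weak_solution u0 u G \<longleftrightarrow>
    L2 u0 \<and> weakly_div_free u0 \<and>
    (\<lambda>(t, x). u t x) \<in> borel_measurable (lebesgue_on ({0<..} \<times> UNIV)) \<and>
    (\<exists>C. AE t in lebesgue. 0 < t \<longrightarrow> L2 (u t) \<and> L2_norm (u t) \<le> C) \<and>
    (AE t in lebesgue. 0 < t \<longrightarrow> weakly_div_free (u t) \<and> weak_gradient (u t) (G t)) \<and>
    (\<lambda>(t, x). G t x) \<in> borel_measurable (lebesgue_on ({0<..} \<times> UNIV)) \<and>
    set_integrable lebesgue ({0<..} \<times> UNIV) (\<lambda>(t, x). (norm (G t x))\<^sup>2) \<and>
    (\<forall>\<phi>. test_function \<phi> \<and> (\<forall>z. (\<Sum>j\<in>UNIV. dx j \<phi> z $ j) = 0) \<longrightarrow>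
      (LINT z:{0<..} \<times> UNIV|lebesgue. (case z of (t, x) \<Rightarrow>
          u t x \<bullet> (dt \<phi> (t, x) + (\<Sum>j\<in>UNIV. dx j (dx j \<phi>) (t, x))
                   + (\<Sum>j\<in>UNIV. (u t x $ j) *\<^sub>R dx j \<phi> (t, x)))))
        + (LINT x|lebesgue. u0 x \<bullet> \<phi> (0, x)) = 0)"

text \<open>The energy inequality is required for almost every time only.  This is implied by the
  version for every \<open>t \<ge> 0\<close> that holds for the weakly continuous representative of \<open>u\<close>.\<close>

definition Leray_solution :: "(real^3 \<Rightarrow> real^3) \<Rightarrow> (real \<Rightarrow> real^3 \<Rightarrow> real^3) \<Rightarrow> bool"
  where "Leray_solution u0 u \<longleftrightarrow> (\<exists>G. NS_weak_solution u0 u G \<and>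
    (AE t in lebesgue. 0 < t \<longrightarrow>
      (L2_norm (u t))\<^sup>2 + 2 * (LINT z:{0<..<t} \<times> UNIV|lebesgue. (case z of (s, x) \<Rightarrow> (norm (G s x))\<^sup>2))
        \<le> (L2_norm u0)\<^sup>2))"

text \<open>As \<open>u\<close> is determined for almost every time only, \<open>\<omega> = curl u\<close> is an identity for almost every
  time; membership in \<open>C((0,T), L\<^sup>\<infinity>)\<close> then fixes \<open>\<omega> t\<close>, up to null sets, for every \<open>t\<close>.\<close>

definition vorticity_on :: "real set \<Rightarrow> (real \<Rightarrow> real^3 \<Rightarrow> real^3) \<Rightarrow> (real \<Rightarrow> real^3 \<Rightarrow> real^3) \<Rightarrow> bool"
  where "vorticity_on I u \<omega> \<longleftrightarrow> (AE t in lebesgue. t \<in> I \<longrightarrow> weak_curl (u t) (\<omega> t))"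


section \<open>Sparseness of super-level sets\<close>

text \<open>Stated for Lebesgue measurable sets instead of open sets only, because super-level sets of an
  arbitrary representative of an \<open>L\<^sup>\<infinity>\<close> class need not be open.\<close>

definition sparse_3d :: "real \<Rightarrow> (real^3) set \<Rightarrow> real^3 \<Rightarrow> real \<Rightarrow> bool"
  where "sparse_3d \<delta> S x0 r \<longleftrightarrow> 0 < \<delta> \<and> \<delta> < 1 \<and> 0 < r \<and> S \<in> sets lebesgue \<and>
    measure lebesgue (S \<inter> ball x0 r) / measure lebesgue (ball x0 r) \<le> \<delta>"

definition pos_part :: "real \<Rightarrow> real"
  where "pos_part a = max a 0"

definition neg_part :: "real \<Rightarrow> real"
  where "neg_part a = - min a 0"

definition V_pos :: "real \<Rightarrow> (real^3 \<Rightarrow> real^3) \<Rightarrow> 3 \<Rightarrow> (real^3) set"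
  where "V_pos M w j = {x. pos_part (w x $ j) > 1 / (2 * M) * Linf_norm w}"

definition V_neg :: "real \<Rightarrow> (real^3 \<Rightarrow> real^3) \<Rightarrow> 3 \<Rightarrow> (real^3) set"
  where "V_neg M w j = {x. neg_part (w x $ j) > 1 / (2 * M) * Linf_norm w}"

definition h_star :: real
  where "h_star = 2 / pi * arcsin ((1 - (3/4) powr (2/3)) / (1 + (3/4) powr (2/3)))"

text \<open>The scale \<open>c / W powr (2/5)\<close> as an extended real: it is infinite, and hence not at most \<open>1\<close>, if the
  vorticity vanishes (\<open>W = 0\<close>), whereas division by zero in \<open>real\<close> would return \<open>0\<close>.\<close>

definition r_star :: "real \<Rightarrow> real \<Rightarrow> ereal"
  where "r_star c W = ereal c / ereal (W powr (2/5))"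

end

theory Submission
  imports Defs
begin

text \<open>Suppose that the set where a signed component \<open>f\<close> of the vorticity exceeds \<open>W/(2M)\<close>, with
  \<open>W = \<parallel>\<omega>(\<tau>)\<parallel>\<^sub>\<infinity>\<close>, fills more than \<open>3/4\<close> of a ball \<open>B\<close> of radius \<open>r\<close>.  Elsewhere in \<open>B\<close> one still has
  \<open>f \<ge> -W\<close>, so that the average of \<open>f\<close> over \<open>B\<close> is at least \<open>(3/(8M) - 1/4) W\<close>.  This is a positive
  multiple of \<open>W\<close>, because \<open>M < 3/2\<close>.  The sharp average may be replaced by the pairing with a smooth
  bump \<open>\<psi>\<close> supported in \<open>B\<close> whose integral is close to the volume of \<open>B\<close>
  (\<open>bump_fills_ball\<close>, \<open>pairing_ge_if_superlevel_dense\<close>).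

  On the other hand a vorticity cannot have a large average: for a coordinate vector \<open>e\<close>, moving the
  curl to the test field gives \<open>\<integral> \<omega> \<bullet> \<psi> e = \<integral> u \<bullet> curl (\<psi> e) \<le> \<parallel>u\<parallel>\<^sub>2 \<parallel>curl (\<psi> e)\<parallel>\<^sub>2\<close>.  The energy inequality
  bounds the first factor by \<open>\<parallel>u\<^sub>0\<parallel>\<^sub>2\<close> and scaling bounds the second by a multiple of \<open>r\<^sup>1\<^sup>/\<^sup>2\<close>
  (\<open>vorticity_pairing_le_energy\<close>, \<open>L2_norm_curl_bump_le\<close>).  Together \<open>W r\<^sup>3 \<le> C \<parallel>u\<^sub>0\<parallel>\<^sub>2 r\<^sup>1\<^sup>/\<^sup>2\<close>, that is
  \<open>W r\<^sup>5\<^sup>/\<^sup>2 \<le> C \<parallel>u\<^sub>0\<parallel>\<^sub>2\<close>.  At the scale \<open>r = c / W\<^sup>2\<^sup>/\<^sup>5\<close> the left side is \<open>c\<^sup>5\<^sup>/\<^sup>2\<close>, so any \<open>c\<close> with \<open>c\<^sup>5\<^sup>/\<^sup>2 > C \<parallel>u\<^sub>0\<parallel>\<^sub>2\<close>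
  excludes the supposed density (\<open>superlevel_set_not_dense\<close>).\<close>

section \<open>Smooth bump functions on a ball\<close>

text \<open>The functions \<open>s \<mapsto> s\<^bsup>-m\<^esup> exp (-1/s)\<close>, extended by \<open>0\<close> to \<open>s \<le> 0\<close>.  The case \<open>m = 0\<close> is the standard
  flat function; the larger exponents arise because differentiation raises \<open>m\<close>.\<close>
definition flat_exp :: "nat \<Rightarrow> real \<Rightarrow> real"
  where "flat_exp m s = (if s \<le> 0 then 0 else inverse s ^ m * exp (- inverse s))"

lemma flat_exp_nonneg: "0 \<le> flat_exp m s"
  by (simp add: flat_exp_def)

text \<open>With \<open>y = 1/s\<close>, the term \<open>y\<^sup>m / m!\<close> of the exponential series is at most \<open>exp y\<close>.\<close>
lemma flat_exp_le_fact: "flat_exp m s \<le> fact m"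
proof (cases "s \<le> 0")
  case False
  define y where "y = inverse s"
  have "0 < y"
    using False by (simp add: y_def)
  have "(\<Sum>n\<in>{m}. y ^ n /\<^sub>R fact n) \<le> (\<Sum>n. y ^ n /\<^sub>R fact n)"
    using \<open>0 < y\<close> by (intro sum_le_suminf sums_summable[OF exp_converges]) auto
  also have "\<dots> = exp y"
    by (rule sums_unique[OF exp_converges, symmetric])
  finally have "y ^ m / fact m \<le> exp y"
    by (simp add: field_simps)
  then have "y ^ m \<le> fact m * exp y"
    by (simp add: field_simps)
  then have "y ^ m * exp (- y) \<le> fact m"
    by (simp add: exp_minus field_simps)
  then show ?thesis
    using False by (simp add: flat_exp_def y_def)
qed (simp add: flat_exp_def)

text \<open>Two powers of \<open>s\<close> are traded for two more in the exponent \<open>m\<close>, at no loss since every \<open>m\<close> is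
  bounded.  Quadratic decay at \<open>0\<close> is what makes the derivative there vanish.\<close>
lemma flat_exp_le_square: "flat_exp m s \<le> fact (m + 2) * s\<^sup>2"
proof (cases "s \<le> 0")
  case False
  then have "flat_exp m s = flat_exp (m + 2) s * s\<^sup>2"
    by (simp add: flat_exp_def power_add field_simps power2_eq_square)
  also have "\<dots> \<le> fact (m + 2) * s\<^sup>2"
    by (intro mult_right_mono flat_exp_le_fact) auto
  finally show ?thesis .
qed (simp add: flat_exp_def)

lemma flat_exp_has_derivative:
  "(flat_exp m has_real_derivative (- real m * flat_exp (m + 1) s + flat_exp (m + 2) s)) (at s)"
proof -
  consider "s < 0" | "s = 0" | "0 < s" by linarith
  then show ?thesis
  proof cases
    case 1
    have "((\<lambda>x. 0) has_real_derivative 0) (at s)" by simp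
    then have "(flat_exp m has_real_derivative 0) (at s)"
      by (rule has_field_derivative_transform_within_open[of _ _ _ "{..<0}"])
        (use 1 in \<open>auto simp: flat_exp_def\<close>)
    then show ?thesis
      using 1 by (simp add: flat_exp_def)
  next
    case 2
    have "((\<lambda>h. (flat_exp m (0 + h) - flat_exp m 0) / h) \<longlongrightarrow> 0) (at 0)"
    proof (rule Lim_null_comparison)
      show "((\<lambda>h. fact (m + 2) * \<bar>h\<bar>) \<longlongrightarrow> (0::real)) (at 0)"
        by (auto intro!: tendsto_eq_intros)
      show "\<forall>\<^sub>F h in at 0. norm ((flat_exp m (0 + h) - flat_exp m 0) / h) \<le> fact (m + 2) * \<bar>h\<bar>"
      proof (rule eventually_at_filter[THEN iffD2], rule always_eventually, safe)
        fix h :: real assume "h \<noteq> 0"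
        have "norm ((flat_exp m (0 + h) - flat_exp m 0) / h) = flat_exp m h / \<bar>h\<bar>"
          by (simp add: flat_exp_nonneg flat_exp_def)
        also have "\<dots> \<le> fact (m + 2) * h\<^sup>2 / \<bar>h\<bar>"
          by (intro divide_right_mono flat_exp_le_square) auto
        also have "\<dots> = fact (m + 2) * \<bar>h\<bar>"
          using \<open>h \<noteq> 0\<close> by (simp add: power2_eq_square abs_if)
        finally show "norm ((flat_exp m (0 + h) - flat_exp m 0) / h) \<le> fact (m + 2) * \<bar>h\<bar>" .
      qed
    qed
    then have "(flat_exp m has_real_derivative 0) (at 0)"
      by (simp add: has_field_derivative_iff)
    then show ?thesis
      using 2 by (simp add: flat_exp_def)
  next
    case 3
    have "((\<lambda>x. inverse x ^ m * exp (- inverse x)) has_real_derivative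
        (- real m * flat_exp (m + 1) s + flat_exp (m + 2) s)) (at s)"
      apply (rule derivative_eq_intros refl | use 3 in force)+
      using 3 by (cases m) (simp_all add: flat_exp_def field_simps power2_eq_square)
    then show ?thesis
      by (rule has_field_derivative_transform_within_open[of _ _ _ "{0<..}"])
        (use 3 in \<open>auto simp: flat_exp_def\<close>)
  qed
qed

text \<open>Instead of formulas for the higher derivatives of a bump function, an algebra that contains the
  bump and is closed under all directional derivatives: it is generated by the coordinates and the
  functions \<open>flat_exp m\<close> of one fixed quadratic, for all \<open>m\<close> at once.\<close>
inductive_set flat_algebra :: "real \<Rightarrow> real \<Rightarrow> 'a::euclidean_space \<Rightarrow> ('a \<Rightarrow> real) set"
  for a b :: real and z :: 'a where
  const: "(\<lambda>x. c) \<in> flat_algebra a b z"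
| linear: "(\<lambda>x. x \<bullet> v) \<in> flat_algebra a b z"
| flat: "(\<lambda>x. flat_exp m (b - a * (norm (x - z))\<^sup>2)) \<in> flat_algebra a b z"
| add: "f \<in> flat_algebra a b z \<Longrightarrow> g \<in> flat_algebra a b z \<Longrightarrow> (\<lambda>x. f x + g x) \<in> flat_algebra a b z"
| mult: "f \<in> flat_algebra a b z \<Longrightarrow> g \<in> flat_algebra a b z \<Longrightarrow> (\<lambda>x. f x * g x) \<in> flat_algebra a b z"

lemma flat_exp_quadratic_has_derivative:
  fixes z :: "'a::euclidean_space"
  shows "((\<lambda>x. flat_exp m (b - a * (norm (x - z))\<^sup>2)) has_derivative
    (\<lambda>v. (- real m * flat_exp (m + 1) (b - a * (norm (x - z))\<^sup>2)
            + flat_exp (m + 2) (b - a * (norm (x - z))\<^sup>2)) * (- 2 * a * ((x - z) \<bullet> v)))) (at x)"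
proof -
  have q: "((\<lambda>x. b - a * (norm (x - z))\<^sup>2) has_derivative (\<lambda>v. - 2 * a * ((x - z) \<bullet> v))) (at x)"
    unfolding power2_norm_eq_inner
    by (rule derivative_eq_intros refl | simp add: inner_commute algebra_simps)+
  show ?thesis
    using diff_chain_at[OF q flat_exp_has_derivative[unfolded has_field_derivative_def]]
    by (simp add: o_def)
qed

lemma flat_algebra_derivative:
  assumes "f \<in> flat_algebra a b z"
  shows "\<exists>f'. (\<forall>x. (f has_derivative f' x) (at x)) \<and> (\<forall>v. (\<lambda>x. f' x v) \<in> flat_algebra a b z)"
  using assms
proof induction
  case (const c)
  show ?case
    by (rule exI[of _ "\<lambda>x v. 0"]) (auto intro: flat_algebra.const)
next
  case (linear v)
  show ?case
    by (rule exI[of _ "\<lambda>x w. w \<bullet> v"])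
      (auto intro: flat_algebra.const intro!: derivative_eq_intros)
next
  case (flat m)
  let ?f' = "\<lambda>x v. (- real m * flat_exp (m + 1) (b - a * (norm (x - z))\<^sup>2)
            + flat_exp (m + 2) (b - a * (norm (x - z))\<^sup>2)) * (- 2 * a * (x \<bullet> v + - (z \<bullet> v)))"
  have "(\<lambda>x. ?f' x v) \<in> flat_algebra a b z" for v
    by (intro flat_algebra.intros)
  moreover have "((\<lambda>x. flat_exp m (b - a * (norm (x - z))\<^sup>2)) has_derivative ?f' x) (at x)" for x
    using flat_exp_quadratic_has_derivative[of m b a z x] by (simp add: inner_diff_left)
  ultimately show ?case
    by (intro exI[of _ ?f'] conjI allI)
next
  case (add f g)
  then obtain f' g' where
    "\<And>x. (f has_derivative f' x) (at x)" "\<And>v. (\<lambda>x. f' x v) \<in> flat_algebra a b z"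
    "\<And>x. (g has_derivative g' x) (at x)" "\<And>v. (\<lambda>x. g' x v) \<in> flat_algebra a b z"
    by auto
  then show ?case
    by (intro exI[of _ "\<lambda>x v. f' x v + g' x v"])
      (auto intro: flat_algebra.intros intro!: has_derivative_add)
next
  case (mult f g)
  then obtain f' g' where
    "\<And>x. (f has_derivative f' x) (at x)" "\<And>v. (\<lambda>x. f' x v) \<in> flat_algebra a b z"
    "\<And>x. (g has_derivative g' x) (at x)" "\<And>v. (\<lambda>x. g' x v) \<in> flat_algebra a b z"
    by auto
  with mult.hyps show ?case
    by (intro exI[of _ "\<lambda>x v. f x * g' x v + f' x v * g x"])
      (auto intro!: has_derivative_mult flat_algebra.add flat_algebra.mult)
qed

text \<open>Smoothness of every order by induction on the order: the derivative is again in the algebra.\<close>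
lemma flat_algebra_ck:
  assumes "f \<in> flat_algebra a b z"
  shows "ck n (\<lambda>x. f x *\<^sub>R e)"
  using assms
proof (induction n arbitrary: f)
  case 0
  then obtain f' where "\<And>x. (f has_derivative f' x) (at x)"
    using flat_algebra_derivative by blast
  then have "continuous_on UNIV f"
    by (meson has_derivative_at_withinI has_derivative_continuous_on)
  then show ?case
    by (auto intro!: continuous_intros)
next
  case (Suc n)
  then obtain f' where f': "\<And>x. (f has_derivative f' x) (at x)"
    and in_alg: "\<And>v. (\<lambda>x. f' x v) \<in> flat_algebra a b z"
    using flat_algebra_derivative by blast
  have D: "((\<lambda>x. f x *\<^sub>R e) has_derivative (\<lambda>v. f' x v *\<^sub>R e)) (at x)" for x
    by (intro has_derivative_scaleR_left f')
  then have "dir_deriv v (\<lambda>x. f x *\<^sub>R e) = (\<lambda>x. f' x v *\<^sub>R e)" for v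
    unfolding dir_deriv_def by (metis frechet_derivative_at)
  with D Suc.IH[OF in_alg] show ?case
    by (auto simp: differentiable_def)
qed

text \<open>For large \<open>k\<close> the bump is close to \<open>1\<close> on most of the ball of centre \<open>z\<close> and radius \<open>r\<close>.  A single
  smooth expression with this property replaces the usual plateau function.\<close>
definition bump :: "real \<Rightarrow> 'a::euclidean_space \<Rightarrow> real \<Rightarrow> 'a \<Rightarrow> real"
  where "bump k z r x = flat_exp 0 (k - k / r\<^sup>2 * (norm (x - z))\<^sup>2)"

lemma bump_nonneg: "0 \<le> bump k z r x"
  and bump_le_1: "bump k z r x \<le> 1"
  using flat_exp_le_fact[of 0] by (simp_all add: bump_def flat_exp_nonneg)

lemma bump_argument_nonpos:
  assumes "0 < k" "0 < r" "r \<le> norm (x - z)"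
  shows "k - k / r\<^sup>2 * (norm (x - z))\<^sup>2 \<le> 0"
proof -
  have "r\<^sup>2 \<le> (norm (x - z))\<^sup>2"
    using assms by (intro power_mono) auto
  then have "k / r\<^sup>2 * r\<^sup>2 \<le> k / r\<^sup>2 * (norm (x - z))\<^sup>2"
    using assms by (intro mult_left_mono) auto
  then show ?thesis
    using assms by simp
qed

lemma bump_outside_ball:
  assumes "0 < k" "0 < r" "x \<notin> ball z r"
  shows "bump k z r x = 0"
  using bump_argument_nonpos[of k r x z] assms
  by (simp add: bump_def flat_exp_def dist_norm norm_minus_commute)

lemma test_function_bump:
  assumes "0 < k" "0 < r"
  shows "test_function (\<lambda>x. bump k z r x *\<^sub>R e)"
proof -
  have "(\<lambda>x. bump k z r x) \<in> flat_algebra (k / r\<^sup>2) k z"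
    unfolding bump_def by (rule flat_algebra.flat)
  moreover have "closure {x. bump k z r x *\<^sub>R e \<noteq> 0} \<subseteq> cball z r"
  proof (rule closure_minimal)
    show "{x. bump k z r x *\<^sub>R e \<noteq> 0} \<subseteq> cball z r"
    proof
      fix x assume "x \<in> {x. bump k z r x *\<^sub>R e \<noteq> 0}"
      then have "x \<in> ball z r"
          using bump_outside_ball[OF assms, of x z] by auto
      then show "x \<in> cball z r"
        by simp
    qed
  qed simp
  then have "compact (closure {x. bump k z r x *\<^sub>R e \<noteq> 0})"
    by (intro compact_eq_bounded_closed[THEN iffD2] conjI bounded_subset[OF bounded_cball]) auto
  ultimately show ?thesis
    unfolding test_function_def by (blast intro: flat_algebra_ck)
qed

text \<open>The derivative is \<open>flat_exp 2\<close> of the quadratic, which is at most \<open>2! = 2\<close>, times the derivative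
  \<open>-2k/r\<^sup>2 (x - z) \<bullet> v\<close> of the quadratic, and \<open>\<bar>x - z\<bar> < r\<close> wherever the first factor is nonzero.\<close>
lemma bump_has_derivative:
  assumes "0 < k" "0 < r"
  obtains D where "(bump k z r has_derivative D) (at x)"
    and "\<And>v. \<bar>D v\<bar> \<le> 4 * k / r * norm v" and "x \<notin> ball z r \<Longrightarrow> D = (\<lambda>v. 0)"
proof
  let ?q = "k - k / r\<^sup>2 * (norm (x - z))\<^sup>2"
  let ?D = "\<lambda>v. flat_exp 2 ?q * (- 2 * (k / r\<^sup>2) * ((x - z) \<bullet> v))"
  show "(bump k z r has_derivative ?D) (at x)"
    using flat_exp_quadratic_has_derivative[of 0 k "k / r\<^sup>2" z x]
    unfolding bump_def[abs_def] by (simp add: numeral_2_eq_2)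
  show out: "?D = (\<lambda>v. 0)" if "x \<notin> ball z r"
    using that bump_argument_nonpos[OF assms, of x z]
    by (simp add: flat_exp_def dist_norm norm_minus_commute)
  show "\<bar>?D v\<bar> \<le> 4 * k / r * norm v" for v
  proof (cases "x \<in> ball z r")
    case True
    have "\<bar>?D v\<bar> = flat_exp 2 ?q * (2 * (k / r\<^sup>2)) * \<bar>(x - z) \<bullet> v\<bar>"
      using assms by (simp add: abs_mult flat_exp_nonneg)
    also have "\<dots> \<le> 2 * (2 * (k / r\<^sup>2)) * (r * norm v)"
    proof (intro mult_mono)
      show "flat_exp 2 ?q \<le> 2"
        using flat_exp_le_fact[of 2 ?q] by (simp add: fact_numeral)
      show "\<bar>(x - z) \<bullet> v\<bar> \<le> r * norm v"
        using True by (intro order_trans[OF Cauchy_Schwarz_ineq2] mult_right_mono)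
          (auto simp: dist_norm norm_minus_commute)
    qed (use assms in auto)
    also have "\<dots> = 4 * k / r * norm v"
      using assms by (simp add: power2_eq_square)
    finally show ?thesis .
  next
    case False
    show ?thesis
    proof -
      have D0: "?D v = 0"
        using fun_cong[OF out[OF False], of v] .
      show ?thesis
        unfolding D0 using assms by simp
    qed
  qed
qed

lemma measure_ball_3:
  assumes "0 \<le> r"
  shows "measure lebesgue (ball (z :: real^3) r) = unit_ball_vol 3 * r ^ 3"
  using content_ball[OF assms, of z] by (simp add: measure_completion)

lemma integrable_continuous_compact_support:
  fixes f :: "'a::euclidean_space \<Rightarrow> 'b::euclidean_space"
  assumes "continuous_on UNIV f" "compact K" "\<And>x. x \<notin> K \<Longrightarrow> f x = 0"
  shows "integrable lebesgue f"
proof -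
  have "integrable lborel (\<lambda>x. indicator K x *\<^sub>R f x)"
    using assms by (intro borel_integrable_compact) (auto intro: continuous_on_subset)
  moreover have "(\<lambda>x. indicator K x *\<^sub>R f x) = f"
    using assms(3) by (auto simp: indicator_def)
  ultimately show ?thesis
    by (simp add: integrable_completion borel_measurable_integrable)
qed

lemma integrable_bump:
  assumes "0 < k" "0 < r"
  shows "integrable lebesgue (bump k (z::'a::euclidean_space) r)"
proof -
  have "continuous_on UNIV (bump k z r)"
    using test_function_bump[OF assms, of z "1::real"] unfolding test_function_def
    by (auto dest: spec[of _ 0])
  then show ?thesis
    by (rule integrable_continuous_compact_support[OF _ compact_cball[of z r]])
      (use bump_outside_ball[OF assms, of _ z] in auto)
qed

text \<open>With \<open>k = n\<^sup>2\<close> the bump is at least \<open>exp (-1/n)\<close> on the concentric ball of radius \<open>(1 - 1/n) r\<close>,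
  which holds the fraction \<open>(1 - 1/n)\<^sup>3\<close> of the volume.  Both factors tend to \<open>1\<close>.  The point is that
  \<open>k\<close> depends neither on the ball's radius nor on its centre.\<close>
lemma bump_fills_ball:
  assumes "0 < \<epsilon>"
  obtains k where "0 < k"
    "\<And>(z::real^3) r. 0 < r \<Longrightarrow> (1 - \<epsilon>) * measure lebesgue (ball z r) \<le> (LINT x|lebesgue. bump k z r x)"
proof -
  have "((\<lambda>n. exp (- 1 / real n) * (1 - 1 / real n) ^ 3) \<longlongrightarrow> exp 0 * (1 - 0) ^ 3) sequentially"
    by (intro tendsto_intros lim_const_over_n lim_1_over_n)
  then have "eventually (\<lambda>n. 1 - \<epsilon> < exp (- 1 / real n) * (1 - 1 / real n) ^ 3) sequentially"
    using assms by (intro order_tendstoD) auto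
  then obtain n where n: "1 - \<epsilon> < exp (- 1 / real n) * (1 - 1 / real n) ^ 3" and "2 \<le> n"
    unfolding eventually_sequentially by (meson nat_le_linear)
  define k where "k = (real n)\<^sup>2"
  define \<rho> where "\<rho> = 1 - 1 / real n"
  have "0 < k" "0 < \<rho>" "\<rho> < 1"
    using \<open>2 \<le> n\<close> by (auto simp: k_def \<rho>_def)
  \<comment> \<open>\<open>k (1 - \<rho>\<^sup>2) = 2n - 1\<close>\<close>
  have gap: "real n \<le> k - k * \<rho>\<^sup>2"
    using \<open>2 \<le> n\<close> by (simp add: k_def \<rho>_def power2_eq_square field_simps)
  have "(1 - \<epsilon>) * measure lebesgue (ball z r) \<le> (LINT x|lebesgue. bump k z r x)"
    if "0 < r" for z :: "real^3" and r
  proof -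
    have low: "exp (- 1 / real n) * indicator (ball z (\<rho> * r)) x \<le> bump k z r x" for x
    proof (cases "x \<in> ball z (\<rho> * r)")
      case True
      let ?q = "k - k / r\<^sup>2 * (norm (x - z))\<^sup>2"
      have "(norm (x - z))\<^sup>2 \<le> (\<rho> * r)\<^sup>2"
        using True by (intro power_mono) (auto simp: dist_norm norm_minus_commute)
      then have "k / r\<^sup>2 * (norm (x - z))\<^sup>2 \<le> k / r\<^sup>2 * (\<rho> * r)\<^sup>2"
        using \<open>0 < k\<close> by (intro mult_left_mono) auto
      also have "\<dots> = k * \<rho>\<^sup>2"
        using that by (simp add: power_mult_distrib)
      finally have q: "real n \<le> ?q"
        using gap by linarith
      then have "0 < ?q"
        using \<open>2 \<le> n\<close> by linarith
      moreover have "inverse ?q \<le> 1 / real n"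
        using q \<open>2 \<le> n\<close> by (simp add: inverse_eq_divide frac_le)
      ultimately show ?thesis
        using True by (simp add: bump_def flat_exp_def)
    qed (simp add: bump_nonneg)
    have "(1 - \<epsilon>) * measure lebesgue (ball z r) \<le> exp (- 1 / real n) * \<rho> ^ 3 * measure lebesgue (ball z r)"
      using n by (intro mult_right_mono) (auto simp: \<rho>_def)
    also have "\<dots> = exp (- 1 / real n) * measure lebesgue (ball z (\<rho> * r))"
      using that \<open>0 < \<rho>\<close> by (subst (1 2) measure_ball_3) (auto simp: power_mult_distrib)
    also have "\<dots> = (LINT x|lebesgue. exp (- 1 / real n) * indicator (ball z (\<rho> * r)) x)"
      by simp
    also have "\<dots> \<le> (LINT x|lebesgue. bump k z r x)"
      by (intro integral_mono integrable_bump \<open>0 < k\<close> that low) 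
        (use lmeasurable_ball[of z "\<rho> * r"] in
          \<open>auto simp: fmeasurable_def intro!: integrable_mult_right integrable_real_indicator\<close>)
    finally show ?thesis .
  qed
  with \<open>0 < k\<close> show ?thesis
    using that by blast
qed

section \<open>Square-integrable and essentially bounded fields\<close>

text \<open>The integral of \<open>(s \<bar>f\<bar> - \<bar>g\<bar>)\<^sup>2\<close> is a nonnegative quadratic polynomial in \<open>s\<close>; evaluate it at its
  minimum.\<close>
lemma Cauchy_Schwarz_integral:
  fixes f g :: "'a::euclidean_space \<Rightarrow> 'b::euclidean_space"
  assumes "L2 f" "L2 g"
  shows "\<bar>LINT x|lebesgue. f x \<bullet> g x\<bar> \<le> L2_norm f * L2_norm g"
proof -
  have [measurable]: "f \<in> borel_measurable lebesgue" "g \<in> borel_measurable lebesgue"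
    and sq: "integrable lebesgue (\<lambda>x. (norm (f x))\<^sup>2)" "integrable lebesgue (\<lambda>x. (norm (g x))\<^sup>2)"
    using assms by (auto simp: L2_def)
  define A where "A = (LINT x|lebesgue. (norm (f x))\<^sup>2)"
  define B where "B = (LINT x|lebesgue. (norm (g x))\<^sup>2)"
  define I where "I = (LINT x|lebesgue. norm (f x) * norm (g x))"
  have young: "norm (f x) * norm (g x) \<le> ((norm (f x))\<^sup>2 + (norm (g x))\<^sup>2) / 2" for x
    using sum_squares_bound[of "norm (f x)" "norm (g x)"] by simp
  have int: "integrable lebesgue (\<lambda>x. norm (f x) * norm (g x))"
    by (rule Bochner_Integration.integrable_bound[of _ "\<lambda>x. ((norm (f x))\<^sup>2 + (norm (g x))\<^sup>2) / 2"])
      (use sq young in \<open>auto simp: abs_mult\<close>)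
  have quad: "0 \<le> A * s\<^sup>2 - 2 * I * s + B" for s
  proof -
    have "0 \<le> (LINT x|lebesgue. (s * norm (f x) - norm (g x))\<^sup>2)"
      by simp
    also have "\<dots> = (LINT x|lebesgue. s\<^sup>2 * (norm (f x))\<^sup>2 - 2 * s * (norm (f x) * norm (g x)) + (norm (g x))\<^sup>2)"
      by (simp add: power2_eq_square algebra_simps)
    also have "\<dots> = s\<^sup>2 * A - 2 * s * I + B"
      using sq int by (simp add: A_def B_def I_def)
    finally show ?thesis
      by (simp add: mult_ac)
  qed
  have "0 \<le> A" "0 \<le> B" "0 \<le> I"
    by (simp_all add: A_def B_def I_def)
  have "I\<^sup>2 \<le> A * B"
  proof (cases "A = 0")
    case True
    \<comment> \<open>The polynomial is then affine in \<open>s\<close>, and it is \<open>-1\<close> at this \<open>s\<close> if \<open>I > 0\<close>.\<close>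
    have "I = 0"
      using quad[of "(B + 1) / (2 * I)"] True \<open>0 \<le> I\<close> by (cases "I = 0") (auto simp: field_simps)
    then show ?thesis
      using True by simp
  next
    case False
    have "A * (I / A)\<^sup>2 - 2 * I * (I / A) + B = B - I\<^sup>2 / A"
      using False by (simp add: field_simps power2_eq_square)
    then have "I\<^sup>2 / A \<le> B"
      using quad[of "I / A"] by simp
    then show ?thesis
      using False \<open>0 \<le> A\<close> by (simp add: field_simps)
  qed
  then have "I \<le> sqrt A * sqrt B"
    using \<open>0 \<le> I\<close> by (metis real_le_rsqrt real_sqrt_mult)
  moreover have "\<bar>LINT x|lebesgue. f x \<bullet> g x\<bar> \<le> I"
    unfolding I_def real_norm_def[symmetric]
  proof (rule Bochner_Integration.integral_norm_bound_integral[OF _ int])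
    show "integrable lebesgue (\<lambda>x. f x \<bullet> g x)"
      by (rule Bochner_Integration.integrable_bound[OF int]) (auto simp: Cauchy_Schwarz_ineq2)
  qed (simp add: Cauchy_Schwarz_ineq2)
  ultimately show ?thesis
    by (simp add: A_def B_def L2_norm_def)
qed

text \<open>The essential supremum of a nonnegative function could only be negative over a null space.\<close>
lemma Linf_norm_nonneg: "0 \<le> Linf_norm w"
  and Linf_AE_le: "Linf w \<Longrightarrow> AE x in lebesgue. infnorm (w x) \<le> Linf_norm w"
proof -
  have ge: "0 \<le> Linf_esssup w"
  proof (rule ccontr)
    assume *: "\<not> 0 \<le> Linf_esssup w"
    have "AE x in lebesgue. ereal (infnorm (w x)) \<le> Linf_esssup w"
      unfolding Linf_esssup_def by (rule esssup_AE)
    then have "AE x in (lebesgue :: (real^3) measure). False"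
    proof eventually_elim
      case (elim x)
      have "(0::ereal) \<le> ereal (infnorm (w x))"
        by (simp add: infnorm_pos_le)
      with elim * show ?case
        by (meson order_trans)
    qed
    then have "emeasure (lebesgue :: (real^3) measure) UNIV = 0"
      by (simp add: AE_iff_null null_sets_def)
    then show False
      by simp
  qed
  then show "0 \<le> Linf_norm w"
    by (simp add: Linf_norm_def real_of_ereal_pos)
  assume "Linf w"
  then have "ereal (Linf_norm w) = Linf_esssup w"
    using ge by (auto simp: Linf_def Linf_norm_def ereal_real)
  moreover have "AE x in lebesgue. ereal (infnorm (w x)) \<le> Linf_esssup w"
    unfolding Linf_esssup_def by (rule esssup_AE)
  ultimately show "AE x in lebesgue. infnorm (w x) \<le> Linf_norm w"
    by (metis (no_types, lifting) AE_cong ereal_less_eq(3))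
qed

lemma Linf_diff:
  assumes "Linf v" "Linf w"
  shows "Linf (\<lambda>x. v x - w x)"
proof -
  have [measurable]: "v \<in> borel_measurable lebesgue" "w \<in> borel_measurable lebesgue"
    using assms by (auto simp: Linf_def)
  have "continuous_on UNIV (infnorm :: real^3 \<Rightarrow> real)"
    by (simp add: continuous_at_imp_continuous_on continuous_infnorm)
  then have [measurable]: "(infnorm :: real^3 \<Rightarrow> real) \<in> borel_measurable borel"
    by (rule borel_measurable_continuous_onI)
  have "AE x in lebesgue. ereal (infnorm (v x - w x)) \<le> ereal (Linf_norm v + Linf_norm w)"
    using Linf_AE_le[OF assms(1)] Linf_AE_le[OF assms(2)]
  proof eventually_elim
    case (elim x)
    show ?case
      using infnorm_triangle[of "v x" "- w x"] elim by (simp add: infnorm_neg)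
  qed
  then have "Linf_esssup (\<lambda>x. v x - w x) \<le> ereal (Linf_norm v + Linf_norm w)"
    unfolding Linf_esssup_def by (intro esssup_I) auto
  then show ?thesis
    by (auto simp: Linf_def le_less_trans)
qed

lemma L2_continuous_compact_support:
  fixes f :: "'a::euclidean_space \<Rightarrow> 'b::euclidean_space"
  assumes "continuous_on UNIV f" "compact K" "\<And>x. x \<notin> K \<Longrightarrow> f x = 0"
  shows "L2 f"
proof -
  have "integrable lebesgue (\<lambda>x. (norm (f x))\<^sup>2)"
    by (rule integrable_continuous_compact_support[OF _ assms(2)])
      (use assms in \<open>auto intro!: continuous_intros\<close>)
  moreover have "f \<in> borel_measurable lebesgue"
    using integrable_continuous_compact_support[OF assms] by (rule borel_measurable_integrable)
  ultimately show ?thesis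
    by (simp add: L2_def)
qed

lemma curl_nth:
  "curl f x $ 1 = partial 2 f x $ 3 - partial 3 f x $ 2"
  "curl f x $ 2 = partial 3 f x $ 1 - partial 1 f x $ 3"
  "curl f x $ 3 = partial 1 f x $ 2 - partial 2 f x $ 1"
  by (simp_all add: curl_def)

text \<open>The curl is continuous and vanishes off the closed support of the test function, where that
  function is locally constant.\<close>
lemma L2_curl_test_function:
  assumes "test_function \<psi>"
  shows "L2 (curl \<psi>)"
proof (rule L2_continuous_compact_support)
  let ?K = "closure {x. \<psi> x \<noteq> 0}"
  show "compact ?K"
    using assms by (simp add: test_function_def)
  have "ck (Suc 0) \<psi>"
    using assms unfolding test_function_def by blast
  then have "continuous_on UNIV (partial j \<psi>)" for j
    by (simp add: partial_def)
  then have "continuous_on UNIV (\<lambda>x. curl \<psi> x $ i)" for i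
    using exhaust_3[of i]
    by (elim disjE) (simp_all add: curl_nth continuous_on_diff continuous_on_component)
  then have "continuous_on UNIV (\<lambda>x. \<chi> i. curl \<psi> x $ i)"
    by (rule continuous_on_vec_lambda)
  then show "continuous_on UNIV (curl \<psi>)"
    by simp
  fix x assume "x \<notin> ?K"
  have "((\<lambda>x. 0) has_derivative (\<lambda>v. 0)) (at x)"
    by simp
  then have "(\<psi> has_derivative (\<lambda>v. 0)) (at x)"
    by (rule has_derivative_transform_within_open[of _ _ _ _ "- ?K"])
      (use \<open>x \<notin> ?K\<close> closure_subset[of "{x. \<psi> x \<noteq> 0}"] in auto)
  then have "partial j \<psi> x = 0" for j
    by (simp add: partial_def dir_deriv_def frechet_derivative_at[symmetric])
  then have "curl \<psi> x $ i = 0" for i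
    using exhaust_3[of i] by (auto simp: curl_nth)
  then show "curl \<psi> x = 0"
    by (simp add: vec_eq_iff)
qed

lemma integrable_inner_Linf_test:
  assumes "Linf w" "test_function \<psi>"
  shows "integrable lebesgue (\<lambda>x. w x \<bullet> \<psi> x)"
    and "\<bar>LINT x|lebesgue. w x \<bullet> \<psi> x\<bar> \<le> sqrt 3 * Linf_norm w * (LINT x|lebesgue. norm (\<psi> x))"
proof -
  have "ck 0 \<psi>" and K: "compact (closure {x. \<psi> x \<noteq> 0})"
    using assms(2) unfolding test_function_def by blast+
  then have \<psi>: "integrable lebesgue \<psi>"
    by (intro integrable_continuous_compact_support[OF _ K])
      (use closure_subset[of "{x. \<psi> x \<noteq> 0}"] in auto)
  then have [measurable]: "w \<in> borel_measurable lebesgue" "\<psi> \<in> borel_measurable lebesgue"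
    using assms(1) by (auto simp: Linf_def)
  have *: "AE x in lebesgue. norm (w x \<bullet> \<psi> x) \<le> sqrt 3 * Linf_norm w * norm (\<psi> x)"
    using Linf_AE_le[OF assms(1)]
  proof eventually_elim
    case (elim x)
    have "\<bar>w x \<bullet> \<psi> x\<bar> \<le> norm (w x) * norm (\<psi> x)"
      by (rule Cauchy_Schwarz_ineq2)
    also have "\<dots> \<le> (sqrt 3 * infnorm (w x)) * norm (\<psi> x)"
      using norm_le_infnorm[of "w x"] by (intro mult_right_mono) auto
    also have "\<dots> \<le> (sqrt 3 * Linf_norm w) * norm (\<psi> x)"
      using elim by (intro mult_right_mono mult_left_mono) auto
    finally show ?case by simp
  qed
  have bound: "integrable lebesgue (\<lambda>x. sqrt 3 * Linf_norm w * norm (\<psi> x))"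
    using \<psi> by simp
  show int: "integrable lebesgue (\<lambda>x. w x \<bullet> \<psi> x)"
    by (rule Bochner_Integration.integrable_bound[OF bound])
      (use * in \<open>auto simp: Linf_norm_nonneg\<close>)
  have "\<bar>LINT x|lebesgue. w x \<bullet> \<psi> x\<bar> \<le> (LINT x|lebesgue. norm (w x \<bullet> \<psi> x))"
    using integral_norm_bound[of lebesgue "\<lambda>x. w x \<bullet> \<psi> x"] by simp
  also have "\<dots> \<le> (LINT x|lebesgue. sqrt 3 * Linf_norm w * norm (\<psi> x))"
    using int bound * by (intro integral_mono_AE) auto
  finally show "\<bar>LINT x|lebesgue. w x \<bullet> \<psi> x\<bar> \<le> sqrt 3 * Linf_norm w * (LINT x|lebesgue. norm (\<psi> x))"
    by simp
qed

section \<open>The energy bound for the vorticity as a distribution\<close>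

text \<open>An interval to the right of \<open>\<tau>\<close> is not a null set, so almost every time includes times arbitrarily
  close to \<open>\<tau>\<close>.\<close>
lemma AE_lebesgue_obtain_near:
  fixes \<tau> T :: real
  assumes "AE t in lebesgue. P t" "0 < \<tau>" "\<tau> < T" "eventually Q (at \<tau> within {0<..<T})"
  obtains t where "t \<in> {0<..<T}" "P t" "Q t"
proof -
  obtain d where "0 < d" and d: "\<And>t. t \<in> {0<..<T} \<Longrightarrow> t \<noteq> \<tau> \<Longrightarrow> dist t \<tau> < d \<Longrightarrow> Q t"
    using assms(4) unfolding eventually_at by blast
  define b where "b = min T (\<tau> + d)"
  have "\<tau> < b"
    using \<open>0 < d\<close> assms by (simp add: b_def)
  have "\<exists>t\<in>{\<tau><..<b}. P t"
  proof (rule ccontr)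
    assume "\<not> (\<exists>t\<in>{\<tau><..<b}. P t)"
    then have sub: "{\<tau><..<b} \<subseteq> {t \<in> space lebesgue. \<not> P t}"
      by auto
    obtain N where N: "{t \<in> space lebesgue. \<not> P t} \<subseteq> N" "emeasure lebesgue N = 0" "N \<in> sets lebesgue"
      using assms(1) by (rule AE_E)
    have "emeasure lebesgue {\<tau><..<b} \<le> emeasure lebesgue N"
      using sub N by (intro emeasure_mono) auto
    then show False
      using N \<open>\<tau> < b\<close> by simp
  qed
  then obtain t where "t \<in> {\<tau><..<b}" "P t" by blast
  with d[of t] show ?thesis
    using assms by (intro that[of t]) (auto simp: b_def dist_real_def)
qed

text \<open>The dissipation integral in the energy inequality is nonnegative.\<close>
lemma Leray_energy_bound:
  assumes "Leray_solution u0 u"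
  shows "AE t in lebesgue. 0 < t \<longrightarrow> L2 (u t) \<and> L2_norm (u t) \<le> L2_norm u0"
proof -
  obtain G where G: "NS_weak_solution u0 u G"
    and en: "AE t in lebesgue. 0 < t \<longrightarrow>
      (L2_norm (u t))\<^sup>2 + 2 * (LINT z:{0<..<t} \<times> UNIV|lebesgue. (case z of (s, x) \<Rightarrow> (norm (G s x))\<^sup>2))
        \<le> (L2_norm u0)\<^sup>2"
    using assms unfolding Leray_solution_def by blast
  obtain C where C: "AE t in lebesgue. 0 < t \<longrightarrow> L2 (u t) \<and> L2_norm (u t) \<le> C"
    using G unfolding NS_weak_solution_def by blast
  show ?thesis
    using en C
  proof eventually_elim
    case (elim t)
    have "0 \<le> (LINT z:{0<..<t} \<times> UNIV|lebesgue. (case z of (s, x) \<Rightarrow> (norm (G s x))\<^sup>2))"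
      unfolding set_lebesgue_integral_def by (intro integral_nonneg_AE) (auto split: prod.split)
    moreover have "0 \<le> L2_norm u0"
      by (simp add: L2_norm_def)
    ultimately show ?case
      using elim by (auto intro: power2_le_imp_le)
  qed
qed

text \<open>For almost every time this is the distributional identity for the curl, Cauchy-Schwarz and the
  energy bound.  Continuity of the vorticity into \<open>L\<^sup>\<infinity>\<close> carries it to every time, because pairing
  with a fixed test function is continuous on \<open>L\<^sup>\<infinity>\<close>.\<close>
lemma vorticity_pairing_le_energy:
  assumes "Leray_solution u0 u" "vorticity_on {0<..<T} u \<omega>" "continuous_into_Linf {0<..<T} \<omega>"
    and "\<tau> \<in> {0<..<T}" "test_function \<psi>"
  shows "(LINT x|lebesgue. \<omega> \<tau> x \<bullet> \<psi> x) \<le> L2_norm u0 * L2_norm (curl \<psi>)"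
proof (rule field_le_epsilon)
  fix \<epsilon> :: real assume "0 < \<epsilon>"
  define N where "N = sqrt 3 * (LINT x|lebesgue. norm (\<psi> x))"
  have "0 \<le> N"
    by (simp add: N_def)
  have "((\<lambda>s. Linf_norm (\<lambda>x. \<omega> s x - \<omega> \<tau> x)) \<longlongrightarrow> 0) (at \<tau> within {0<..<T})"
    using assms unfolding continuous_into_Linf_def by blast
  then have "eventually (\<lambda>s. Linf_norm (\<lambda>x. \<omega> s x - \<omega> \<tau> x) < \<epsilon> / (N + 1)) (at \<tau> within {0<..<T})"
    using \<open>0 < \<epsilon>\<close> \<open>0 \<le> N\<close> by (intro order_tendstoD) auto
  moreover have "AE t in lebesgue. t \<in> {0<..<T} \<longrightarrow>
      weak_curl (u t) (\<omega> t) \<and> L2 (u t) \<and> L2_norm (u t) \<le> L2_norm u0"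
    using assms(2)[unfolded vorticity_on_def] Leray_energy_bound[OF assms(1)]
    by eventually_elim auto
  ultimately obtain t where t: "t \<in> {0<..<T}" "weak_curl (u t) (\<omega> t)" "L2 (u t)"
    "L2_norm (u t) \<le> L2_norm u0" and close: "Linf_norm (\<lambda>x. \<omega> t x - \<omega> \<tau> x) < \<epsilon> / (N + 1)"
    using AE_lebesgue_obtain_near assms(4) by (smt (verit, best) greaterThanLessThan_iff)
  have Linf: "Linf (\<omega> t)" "Linf (\<omega> \<tau>)"
    using assms(3,4) t(1) by (auto simp: continuous_into_Linf_def)
  have "(LINT x|lebesgue. \<omega> \<tau> x \<bullet> \<psi> x) =
      (LINT x|lebesgue. \<omega> t x \<bullet> \<psi> x) - (LINT x|lebesgue. (\<omega> t x - \<omega> \<tau> x) \<bullet> \<psi> x)"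
    using integrable_inner_Linf_test(1)[OF _ assms(5)] Linf by (simp add: inner_diff_left)
  moreover have "(LINT x|lebesgue. \<omega> t x \<bullet> \<psi> x) \<le> L2_norm u0 * L2_norm (curl \<psi>)"
  proof -
    have "(LINT x|lebesgue. \<omega> t x \<bullet> \<psi> x) = (LINT x|lebesgue. u t x \<bullet> curl \<psi> x)"
      using t(2) assms(5) by (simp add: weak_curl_def)
    also have "\<dots> \<le> L2_norm (u t) * L2_norm (curl \<psi>)"
      using Cauchy_Schwarz_integral[OF t(3) L2_curl_test_function[OF assms(5)]] by simp
    also have "\<dots> \<le> L2_norm u0 * L2_norm (curl \<psi>)"
      using t(4) by (intro mult_right_mono) (auto simp: L2_norm_def)
    finally show ?thesis .
  qed
  moreover have "- (LINT x|lebesgue. (\<omega> t x - \<omega> \<tau> x) \<bullet> \<psi> x) \<le> \<epsilon>"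
  proof -
    have "\<bar>LINT x|lebesgue. (\<omega> t x - \<omega> \<tau> x) \<bullet> \<psi> x\<bar> \<le> Linf_norm (\<lambda>x. \<omega> t x - \<omega> \<tau> x) * N"
      using integrable_inner_Linf_test(2)[OF Linf_diff[OF Linf] assms(5)] by (simp add: N_def mult_ac)
    also have "\<dots> \<le> \<epsilon> / (N + 1) * (N + 1)"
      using close \<open>0 \<le> N\<close> \<open>0 < \<epsilon>\<close> by (intro mult_mono) auto
    finally show ?thesis
      using \<open>0 \<le> N\<close> by auto
  qed
  ultimately show "(LINT x|lebesgue. \<omega> \<tau> x \<bullet> \<psi> x) \<le> L2_norm u0 * L2_norm (curl \<psi>) + \<epsilon>"
    by linarith
qed

section \<open>Density of super-level sets against the energy\<close>

lemma norm_curl_directed_le: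
  fixes f :: "real^3 \<Rightarrow> real" and e :: "real^3"
  assumes D: "(f has_derivative D) (at x)" and K: "\<And>v. \<bar>D v\<bar> \<le> K * norm v"
    and e: "\<And>i. \<bar>e $ i\<bar> \<le> 1"
  shows "norm (curl (\<lambda>x. f x *\<^sub>R e) x) \<le> 6 * K"
proof -
  have "((\<lambda>x. f x *\<^sub>R e) has_derivative (\<lambda>v. D v *\<^sub>R e)) (at x)"
    by (intro has_derivative_scaleR_left D)
  then have p: "partial j (\<lambda>x. f x *\<^sub>R e) x = D (axis j 1) *\<^sub>R e" for j
    by (simp add: partial_def dir_deriv_def frechet_derivative_at[symmetric])
  have "\<bar>D (axis j 1) * e $ i\<bar> \<le> K * 1" for i j
    unfolding abs_mult using K[of "axis j 1"] e[of i] by (intro mult_mono) auto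
  then have b: "\<bar>D (axis j 1) * e $ i\<bar> \<le> K" for i j
    by simp
  have "\<bar>curl (\<lambda>x. f x *\<^sub>R e) x $ i\<bar> \<le> 2 * K" for i
    using exhaust_3[of i] b[of 1 2] b[of 1 3] b[of 2 1] b[of 2 3] b[of 3 1] b[of 3 2]
    by (elim disjE) (simp_all add: curl_nth p)
  then have "(\<Sum>i\<in>UNIV. \<bar>curl (\<lambda>x. f x *\<^sub>R e) x $ i\<bar>) \<le> (\<Sum>i\<in>(UNIV::3 set). 2 * K)"
    by (intro sum_mono)
  then show ?thesis
    using norm_le_l1_cart[of "curl (\<lambda>x. f x *\<^sub>R e) x"] by simp
qed

text \<open>The gradient of the bump is at most of order \<open>1/r\<close>, and it vanishes off the ball.  In three
  dimensions the bound is therefore of order \<open>r\<^sup>1\<^sup>/\<^sup>2\<close>, while the volume is of order \<open>r\<^sup>3\<close>; the exponent \<open>5/2\<close>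
  of \<open>r\<close> in \<open>superlevel_set_not_dense\<close> is the difference.\<close>
lemma L2_norm_curl_bump_le:
  fixes e z :: "real^3"
  assumes "0 < k" "0 < r" and e: "\<And>i. \<bar>e $ i\<bar> \<le> 1"
  shows "L2_norm (curl (\<lambda>x. bump k z r x *\<^sub>R e)) \<le> 24 * k / r * sqrt (measure lebesgue (ball z r))"
proof -
  let ?c = "curl (\<lambda>x. bump k z r x *\<^sub>R e)" and ?K = "24 * k / r"
  have pt: "(norm (?c x))\<^sup>2 \<le> ?K\<^sup>2 * indicator (ball z r) x" for x
  proof -
    obtain D where D: "(bump k z r has_derivative D) (at x)"
      and K: "\<And>v. \<bar>D v\<bar> \<le> 4 * k / r * norm v" and out: "x \<notin> ball z r \<Longrightarrow> D = (\<lambda>v. 0)"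
      using bump_has_derivative[OF assms(1,2)] by blast
    show ?thesis
    proof (cases "x \<in> ball z r")
      case True
      have "norm (?c x) \<le> ?K"
        using norm_curl_directed_le[OF D K e] by simp
      then show ?thesis
        using True by (simp add: power_mono)
    next
      case False
      have "norm (?c x) \<le> 6 * 0"
        by (rule norm_curl_directed_le[OF D _ e]) (simp add: out[OF False])
      then show ?thesis
        using False by simp
    qed
  qed
  have "L2 ?c"
    by (intro L2_curl_test_function test_function_bump assms)
  then have "(LINT x|lebesgue. (norm (?c x))\<^sup>2) \<le> (LINT x|lebesgue. ?K\<^sup>2 * indicator (ball z r) x)"
    using lmeasurable_ball[of z r] pt
    by (intro integral_mono) 
      (auto simp: L2_def fmeasurable_def intro!: integrable_mult_right integrable_real_indicator)
  then have "L2_norm ?c \<le> sqrt (?K\<^sup>2 * measure lebesgue (ball z r))"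
    by (simp add: L2_norm_def)
  also have "\<dots> = ?K * sqrt (measure lebesgue (ball z r))"
    using assms(1,2) by (subst real_sqrt_mult) simp
  finally show ?thesis .
qed

text \<open>Pointwise \<open>f \<psi> \<ge> L \<psi>\<close> on the super-level set.  On the rest of \<open>B\<close>, where only \<open>f \<ge> -W\<close> is
  known, the deficit is at most \<open>L + W\<close>, on a set of relative measure at most \<open>1 - \<delta>\<close>.\<close>
lemma pairing_ge_if_superlevel_dense:
  fixes f \<psi> :: "'a::euclidean_space \<Rightarrow> real"
  assumes f [measurable]: "f \<in> borel_measurable lebesgue" and W: "AE x in lebesgue. \<bar>f x\<bar> \<le> W"
    and "0 \<le> L" "0 \<le> W"
    and \<psi>: "integrable lebesgue \<psi>" "\<And>x. 0 \<le> \<psi> x" "\<And>x. \<psi> x \<le> 1" "\<And>x. x \<notin> B \<Longrightarrow> \<psi> x = 0"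
    and B: "B \<in> lmeasurable"
    and fill: "(1 - \<epsilon>) * measure lebesgue B \<le> (LINT x|lebesgue. \<psi> x)"
    and dense: "\<delta> * measure lebesgue B \<le> measure lebesgue ({x. L < f x} \<inter> B)"
  shows "(L * (\<delta> - \<epsilon>) - W * (1 - \<delta>)) * measure lebesgue B \<le> (LINT x|lebesgue. f x * \<psi> x)"
proof -
  have [measurable]: "\<psi> \<in> borel_measurable lebesgue"
    using \<psi>(1) by auto
  let ?S = "{x. L < f x}"
  have "{x \<in> space lebesgue. L < f x} \<in> sets lebesgue"
    by measurable
  then have S: "?S \<in> sets lebesgue"
    by simp
  have SB: "?S \<inter> B \<in> lmeasurable" and BS: "B - ?S \<in> lmeasurable"
    using B S fmeasurable_Int_fmeasurable[OF B S] by (auto simp: Int_commute fmeasurable_Diff)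
  have "measure lebesgue B = measure lebesgue (?S \<inter> B) + measure lebesgue (B - ?S)"
    using measure_Un2[OF SB B] by (simp add: Diff_Int_distrib2 Un_absorb1 Diff_Int)
  with dense have rest: "measure lebesgue (B - ?S) \<le> (1 - \<delta>) * measure lebesgue B"
    by (simp add: algebra_simps)
  have int: "integrable lebesgue (\<lambda>x. f x * \<psi> x)"
  proof (rule Bochner_Integration.integrable_bound)
    show "integrable lebesgue (\<lambda>x. W * \<psi> x)"
      using \<psi>(1) by simp
    show "AE x in lebesgue. norm (f x * \<psi> x) \<le> norm (W * \<psi> x)"
      using W by eventually_elim (use \<psi>(2) \<open>0 \<le> W\<close> in \<open>auto simp: abs_mult intro!: mult_right_mono\<close>)
  qed simp
  have ind: "integrable lebesgue (\<lambda>x. (L + W) * indicator (B - ?S) x)"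
    using BS by (auto simp: fmeasurable_def intro!: integrable_mult_right integrable_real_indicator)
  have "(L * (\<delta> - \<epsilon>) - W * (1 - \<delta>)) * measure lebesgue B =
      L * ((1 - \<epsilon>) * measure lebesgue B) - (L + W) * ((1 - \<delta>) * measure lebesgue B)"
    by (simp add: algebra_simps)
  also have "\<dots> \<le> L * (LINT x|lebesgue. \<psi> x) - (L + W) * measure lebesgue (B - ?S)"
    using fill rest \<open>0 \<le> L\<close> \<open>0 \<le> W\<close> by (intro diff_mono mult_left_mono) auto
  also have "\<dots> = (LINT x|lebesgue. L * \<psi> x - (L + W) * indicator (B - ?S) x)"
    using \<psi>(1) ind by simp
  also have "\<dots> \<le> (LINT x|lebesgue. f x * \<psi> x)"
  proof (rule integral_mono_AE)
    show "integrable lebesgue (\<lambda>x. L * \<psi> x - (L + W) * indicator (B - ?S) x)"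
      using \<psi>(1) ind by simp
    show "AE x in lebesgue. L * \<psi> x - (L + W) * indicator (B - ?S) x \<le> f x * \<psi> x"
      using W
    proof eventually_elim
      case (elim x)
      consider "x \<notin> B" | "x \<in> B" "L < f x" | "x \<in> B - ?S"
        by auto
      then show ?case
      proof cases
        case 1
        then show ?thesis by (simp add: \<psi>(4))
      next
        case 2
        then show ?thesis by (simp add: \<psi>(2) mult_right_mono)
      next
        case 3
        have "(L - f x) * \<psi> x \<le> (L + W) * 1"
          using elim \<psi>(2,3)[of x] 3 \<open>0 \<le> L\<close> \<open>0 \<le> W\<close> by (intro mult_mono) auto
        then show ?thesis
          using 3 by (simp add: algebra_simps)
      qed
    qed
  qed (rule int)
  finally show ?thesis .
qed

text \<open>A super-level set that is dense in a ball forces the vorticity to pair with the bump to at least a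
  multiple of \<open>\<parallel>\<omega>(\<tau>)\<parallel>\<^sub>\<infinity> r\<^sup>3\<close>, against the upper bound of order \<open>\<parallel>u\<^sub>0\<parallel>\<^sub>2 r\<^sup>1\<^sup>/\<^sup>2\<close>.  The hypothesis \<open>large\<close> is the
  failure of the resulting inequality.  The vector \<open>e\<close> selects a component and a sign.\<close>
lemma superlevel_set_not_dense:
  fixes e z :: "real^3"
  assumes sol: "Leray_solution u0 u" "vorticity_on {0<..<T} u \<omega>" "continuous_into_Linf {0<..<T} \<omega>"
    and \<tau>: "\<tau> \<in> {0<..<T}"
    and e: "\<And>i. \<bar>e $ i\<bar> \<le> 1" "\<And>v. \<bar>v \<bullet> e\<bar> \<le> infnorm v"
    and k: "0 < k" "\<And>(z::real^3) r. 0 < r \<Longrightarrow>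
      (1 - \<epsilon>) * measure lebesgue (ball z r) \<le> (LINT x|lebesgue. bump k z r x)"
    and "0 \<le> \<theta>" "0 < r"
    and large: "24 * k * L2_norm u0 <
      (\<theta> * (\<delta> - \<epsilon>) - (1 - \<delta>)) * (sqrt (unit_ball_vol 3) * (Linf_norm (\<omega> \<tau>) * r powr (5/2)))"
  shows "measure lebesgue ({x. \<theta> * Linf_norm (\<omega> \<tau>) < \<omega> \<tau> x \<bullet> e} \<inter> ball z r) \<le> \<delta> * measure lebesgue (ball z r)"
proof (rule ccontr)
  assume dense: "\<not> ?thesis"
  define W where "W = Linf_norm (\<omega> \<tau>)"
  define \<kappa> where "\<kappa> = \<theta> * (\<delta> - \<epsilon>) - (1 - \<delta>)"
  define m where "m = measure lebesgue (ball z r)"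
  have Linf: "Linf (\<omega> \<tau>)"
    using sol(3) \<tau> by (auto simp: continuous_into_Linf_def)
  then have [measurable]: "\<omega> \<tau> \<in> borel_measurable lebesgue"
    by (simp add: Linf_def)
  have "0 \<le> W"
    by (simp add: W_def Linf_norm_nonneg)
  have "\<kappa> * W * m = (\<theta> * W * (\<delta> - \<epsilon>) - W * (1 - \<delta>)) * m"
    by (simp add: \<kappa>_def algebra_simps)
  also have "\<dots> \<le> (LINT x|lebesgue. (\<omega> \<tau> x \<bullet> e) * bump k z r x)"
    unfolding m_def
  proof (rule pairing_ge_if_superlevel_dense)
    show "AE x in lebesgue. \<bar>\<omega> \<tau> x \<bullet> e\<bar> \<le> W"
      using Linf_AE_le[OF Linf] by eventually_elim (use e(2) W_def order_trans in blast)
    show "\<delta> * measure lebesgue (ball z r) \<le> measure lebesgue ({x. \<theta> * W < \<omega> \<tau> x \<bullet> e} \<inter> ball z r)"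
      using dense by (simp add: W_def)
  qed (use k \<open>0 < r\<close> \<open>0 \<le> \<theta>\<close> \<open>0 \<le> W\<close> in
      \<open>auto intro: integrable_bump bump_nonneg bump_le_1 bump_outside_ball\<close>)
  also have "\<dots> = (LINT x|lebesgue. \<omega> \<tau> x \<bullet> (bump k z r x *\<^sub>R e))"
    by (simp add: mult.commute)
  also have "\<dots> \<le> L2_norm u0 * L2_norm (curl (\<lambda>x. bump k z r x *\<^sub>R e))"
    by (intro vorticity_pairing_le_energy[OF sol \<tau>] test_function_bump k \<open>0 < r\<close>)
  also have "\<dots> \<le> L2_norm u0 * (24 * k / r * sqrt m)"
    unfolding m_def by (intro mult_left_mono L2_norm_curl_bump_le k \<open>0 < r\<close> e) (simp add: L2_norm_def)
  finally have "\<kappa> * W * m * r \<le> 24 * k * L2_norm u0 * sqrt m"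
    using \<open>0 < r\<close> by (simp add: field_simps)
  moreover have m: "m = unit_ball_vol 3 * r ^ 3"
    unfolding m_def using \<open>0 < r\<close> by (intro measure_ball_3) simp
  then have "0 < m"
    using \<open>0 < r\<close> by simp
  ultimately have "\<kappa> * W * (sqrt m * r) * sqrt m \<le> 24 * k * L2_norm u0 * sqrt m"
    by (simp add: mult_ac)
  then have "\<kappa> * W * (sqrt m * r) \<le> 24 * k * L2_norm u0"
    using \<open>0 < m\<close> by (simp only: mult_le_cancel_right_pos real_sqrt_gt_zero)
  moreover have "sqrt m * r = sqrt (unit_ball_vol 3) * r powr (5/2)"
  proof -
    have "sqrt (r ^ 3) * r = (r powr 3) powr (1/2) * r powr 1"
      using \<open>0 < r\<close> by (simp add: powr_half_sqrt)
    also have "\<dots> = r powr (5/2)"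
      unfolding powr_powr powr_add[symmetric] by simp
    finally show ?thesis
      by (simp add: m real_sqrt_mult)
  qed
  ultimately have "\<kappa> * (sqrt (unit_ball_vol 3) * (W * r powr (5/2))) \<le> 24 * k * L2_norm u0"
    by (simp add: mult_ac)
  then show False
    using large by (simp add: W_def \<kappa>_def)
qed

section \<open>The constants and the sparseness of the vorticity\<close>

text \<open>From \<open>3/4 \<le> (3/4)\<^sup>2\<^sup>/\<^sup>3 < 1\<close> the argument of the arcsine is positive and below \<open>1/2 = sin (\<pi>/6)\<close>.\<close>
lemma h_star_bounds: "0 < h_star" "h_star < 1/3"
proof -
  define p :: real where "p = (3/4) powr (2/3)"
  have "(3/4) powr 1 \<le> p"
    unfolding p_def by (intro powr_mono') auto
  then have "3/4 \<le> p" by simp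
  have "p < 1"
    using powr_less_mono2[of "2/3" "3/4" "1::real"] by (simp add: p_def)
  define a where "a = (1 - p) / (1 + p)"
  have "0 < a" "a < 1/2"
    using \<open>3/4 \<le> p\<close> \<open>p < 1\<close> by (simp_all add: a_def field_simps)
  have pos: "0 < arcsin a"
    using \<open>0 < a\<close> \<open>a < 1/2\<close> arcsin_less_arcsin[of 0 a] by simp
  have less: "arcsin a < pi / 6"
    using \<open>0 < a\<close> \<open>a < 1/2\<close> arcsin_less_arcsin[of a "1/2"] arcsin_sin[of "pi / 6"] by (simp add: sin_30)
  have h: "h_star = 2 / pi * arcsin a"
    by (simp add: h_star_def a_def p_def)
  show "0 < h_star" "h_star < 1/3"
    unfolding h using pos less by (simp_all add: field_simps)
qed

theorem theorem26:
  fixes M :: real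
  assumes M: "1/2 * h_star + (1 - h_star) * M = 1"
  shows "1 < M \<and> M < 3/2 \<and>
    (\<exists>c :: real \<Rightarrow> real. (\<forall>E\<ge>0. c E > 0) \<and>
      (\<forall>(u0 :: real^3 \<Rightarrow> real^3) u \<omega> T.
        Leray_solution u0 u \<and> T > 0 \<and> vorticity_on {0<..<T} u \<omega> \<and>
        continuous_into_Linf {0<..<T} \<omega> \<longrightarrow>
        (\<forall>\<tau>\<in>{0<..<T}. \<forall>r. ereal r = r_star (c (L2_norm u0)) (Linf_norm (\<omega> \<tau>)) \<and> r \<le> 1 \<longrightarrow>
          (\<forall>j. (\<forall>x0. sparse_3d (3/4) (V_pos M (\<omega> \<tau>) j) x0 r \<and>
                     sparse_3d (3/4) (V_neg M (\<omega> \<tau>) j) x0 r) \<and>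
               (continuous_on UNIV (\<omega> \<tau>) \<longrightarrow>
                  open (V_pos M (\<omega> \<tau>) j) \<and> open (V_neg M (\<omega> \<tau>) j))))))"
proof (intro conjI)
  have "M * (1 - h_star) = 1 - h_star / 2"
    using M by (simp add: algebra_simps)
  then have M_eq: "M = (1 - h_star / 2) / (1 - h_star)"
    using h_star_bounds by (simp add: field_simps)
  show "1 < M" "M < 3/2"
    using h_star_bounds by (simp_all add: M_eq field_simps)
  \<comment> \<open>The density \<open>3/4\<close> outweighs the remaining quarter, where the component may be as low as
    \<open>-\<parallel>\<omega>\<parallel>\<^sub>\<infinity>\<close>, exactly when \<open>3/4 \<cdot> 1/(2M) > 1/4\<close>, that is when \<open>M < 3/2\<close>.  Half of this margin is
    left to the bump, so that \<open>\<kappa> = (3/4 - M/2) / (4M)\<close>.\<close>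
  define \<epsilon> where "\<epsilon> = (3/4 - M/2) / 2"
  define \<kappa> where "\<kappa> = 1 / (2 * M) * (3/4 - \<epsilon>) - (1 - 3/4)"
  have "0 < \<epsilon>" "0 < \<kappa>"
    using \<open>1 < M\<close> \<open>M < 3/2\<close> by (auto simp: \<epsilon>_def \<kappa>_def field_simps)
  obtain k where k: "0 < k" "\<And>(z::real^3) r. 0 < r \<Longrightarrow>
      (1 - \<epsilon>) * measure lebesgue (ball z r) \<le> (LINT x|lebesgue. bump k z r x)"
    using bump_fills_ball[OF \<open>0 < \<epsilon>\<close>] by blast
  define b where "b = \<kappa> * sqrt (unit_ball_vol 3)"
  have "0 < b"
    using \<open>0 < \<kappa>\<close> by (simp add: b_def)
  \<comment> \<open>At the scale \<open>r = c E / W\<^sup>2\<^sup>/\<^sup>5\<close> the product \<open>W r\<^sup>5\<^sup>/\<^sup>2\<close> is \<open>(c E)\<^sup>5\<^sup>/\<^sup>2\<close>, which has to exceed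
    \<open>24 k E / b\<close>.  The summand \<open>1\<close> makes the inequality strict and covers \<open>E = 0\<close>.\<close>
  define c where "c E = (24 * k * E / b + 1) powr (2/5)" for E
  have c_base: "0 < 24 * k * E / b + 1" if "0 \<le> E" for E
    using that \<open>0 < b\<close> \<open>0 < k\<close> by (intro add_nonneg_pos) auto
  show "\<exists>c :: real \<Rightarrow> real. (\<forall>E\<ge>0. c E > 0) \<and>
      (\<forall>(u0 :: real^3 \<Rightarrow> real^3) u \<omega> T.
        Leray_solution u0 u \<and> T > 0 \<and> vorticity_on {0<..<T} u \<omega> \<and>
        continuous_into_Linf {0<..<T} \<omega> \<longrightarrow>
        (\<forall>\<tau>\<in>{0<..<T}. \<forall>r. ereal r = r_star (c (L2_norm u0)) (Linf_norm (\<omega> \<tau>)) \<and> r \<le> 1 \<longrightarrow>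
          (\<forall>j. (\<forall>x0. sparse_3d (3/4) (V_pos M (\<omega> \<tau>) j) x0 r \<and>
                     sparse_3d (3/4) (V_neg M (\<omega> \<tau>) j) x0 r) \<and>
               (continuous_on UNIV (\<omega> \<tau>) \<longrightarrow>
                  open (V_pos M (\<omega> \<tau>) j) \<and> open (V_neg M (\<omega> \<tau>) j)))))"
  proof (rule exI[of _ c], intro conjI allI impI ballI; (elim conjE)?)
    show "0 < c E" if "0 \<le> E" for E
      using c_base[OF that] by (simp add: c_def)
  next
    fix u0 :: "real^3 \<Rightarrow> real^3" and u \<omega> T \<tau> r j
    assume sol: "Leray_solution u0 u" "vorticity_on {0<..<T} u \<omega>" "continuous_into_Linf {0<..<T} \<omega>"
      and \<tau>: "\<tau> \<in> {0<..<T}"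
      and r: "ereal r = r_star (c (L2_norm u0)) (Linf_norm (\<omega> \<tau>))"
    define W where "W = Linf_norm (\<omega> \<tau>)"
    define C where "C = 24 * k * L2_norm u0 / b + 1"
    have "0 < C"
      unfolding C_def by (rule c_base) (simp add: L2_norm_def)
    have cC: "c (L2_norm u0) = C powr (2/5)"
      by (simp add: c_def C_def)
    have "0 \<le> W"
      by (simp add: W_def Linf_norm_nonneg)
    \<comment> \<open>For zero vorticity the scale is infinite, so no real \<open>r\<close> equals it.\<close>
    moreover have "W \<noteq> 0"
      using r \<open>0 < C\<close> unfolding W_def[symmetric] by (auto simp: r_star_def cC)
    ultimately have "0 < W" by simp
    have r_eq: "r = C powr (2/5) / W powr (2/5)"
      using r \<open>0 < W\<close> unfolding W_def[symmetric] by (simp add: r_star_def cC)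
    have "0 < r"
      using \<open>0 < C\<close> \<open>0 < W\<close> by (simp add: r_eq)
    have "W * r powr (5/2) = C"
      using \<open>0 < C\<close> \<open>0 < W\<close> by (simp add: r_eq powr_divide powr_powr)
    moreover have "24 * k * L2_norm u0 < b * C"
      using \<open>0 < b\<close> by (simp add: C_def field_simps)
    ultimately have large: "24 * k * L2_norm u0 <
        (1 / (2 * M) * (3/4 - \<epsilon>) - (1 - 3/4)) * (sqrt (unit_ball_vol 3) * (Linf_norm (\<omega> \<tau>) * r powr (5/2)))"
      by (simp add: b_def \<kappa>_def W_def mult_ac)
    have Lpos: "0 \<le> 1 / (2 * M) * W"
      using \<open>1 < M\<close> \<open>0 < W\<close> by simp
    have [measurable]: "\<omega> \<tau> \<in> borel_measurable lebesgue"
      using sol(3) \<tau> by (auto simp: continuous_into_Linf_def Linf_def)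
    have sparse: "sparse_3d (3/4) {x. 1 / (2 * M) * W < \<omega> \<tau> x \<bullet> e} x0 r"
      if e: "e = axis j 1 \<or> e = - axis j 1" for e x0
    proof -
      have "\<bar>e $ i\<bar> \<le> 1" for i
        using e by (auto simp: axis_def)
      moreover have "\<bar>v \<bullet> e\<bar> \<le> infnorm v" for v
        using e component_le_infnorm_cart[of v j] by (auto simp: inner_axis)
      ultimately have "measure lebesgue ({x. 1 / (2 * M) * W < \<omega> \<tau> x \<bullet> e} \<inter> ball x0 r)
          \<le> 3/4 * measure lebesgue (ball x0 r)"
        unfolding W_def using \<open>1 < M\<close> \<open>0 < r\<close> large
        by (intro superlevel_set_not_dense[OF sol \<tau> _ _ k]) auto
      moreover have "{x \<in> space lebesgue. 1 / (2 * M) * W < \<omega> \<tau> x \<bullet> e} \<in> sets lebesgue"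
        by measurable
      moreover have "0 < measure lebesgue (ball x0 r)"
        using \<open>0 < r\<close> by (subst measure_ball_3) auto
      ultimately show ?thesis
        using \<open>0 < r\<close> by (simp add: sparse_3d_def field_simps)
    qed
    have V_pos: "V_pos M (\<omega> \<tau>) j = {x. 1 / (2 * M) * W < \<omega> \<tau> x \<bullet> axis j 1}"
      and V_neg: "V_neg M (\<omega> \<tau>) j = {x. 1 / (2 * M) * W < \<omega> \<tau> x \<bullet> - axis j 1}"
      using Lpos unfolding V_pos_def V_neg_def W_def[symmetric]
      by (auto simp: pos_part_def neg_part_def inner_axis max_def min_def)
    show "sparse_3d (3/4) (V_pos M (\<omega> \<tau>) j) x0 r" "sparse_3d (3/4) (V_neg M (\<omega> \<tau>) j) x0 r" for x0
      unfolding V_pos V_neg by (rule sparse; simp)+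
    show "open (V_pos M (\<omega> \<tau>) j)" "open (V_neg M (\<omega> \<tau>) j)" if "continuous_on UNIV (\<omega> \<tau>)"
      unfolding V_pos V_neg using that by (auto intro!: open_Collect_less continuous_intros)
  qed
qed

end
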